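(* Let $\mathfrak{v}=\mathfrak{v}_{(\psi,Q,\gamma)}$ for any $Q\in L\setminus L^\circ$. Then the valuations of the semi-canonical generators of $A(L)$ generate the value semigroup $S(R_X,\mathfrak{v})$. In particular, the semi-canonical generators form a Khovanskii basis for $\mathfrak{v}$ if $\mathfrak{v}$ is of full rank.
   Context: $\mathbb{K}$ is an algebraically closed field; $T$ is an algebraic torus with character lattice $M$ and cocharacter lattice $N$. Let $m\ge1$, $\sigma\subset N_\mathbb{Q}$ a pointed polyhedral cone, and $\Delta_0,\dots,\Delta_m$ each either empty or a polyhedron in $N_\mathbb{Q}$ with tailcone $\{v:\Delta_i+v\subseteq\Delta_i\}=\sigma$, with $\sum_i\Delta_i\subsetneq\sigma$. For $u\in\sigma^\vee$, $\Delta_i(u)=\min_{v\in\Delta_i}\langle v,u\rangle$, $\infty$ if $\Delta_i=\emptyset$ (a coefficient $\infty$ allows poles of arbitrary order). Let $L\subset\mathbb{P}^m=\mathrm{Proj}\,\mathbb{K}[y_0,\dots,y_m]$ be a line meeting the dense torus $(\mathbb{K}^* )^m$, $L^\circ=L\cap(\mathbb{K}^* )^m$, $z_i=y_i/y_0$, $Q_i$ the restriction of $V(y_i)$ to $L$, and $$R_X=A(L)=\bigoplus_{u\in\sigma^\vee\cap M}H^0\Big(L,\mathcal{O}\big(\textstyle\sum_i\lfloor\Delta_i(u)\rfloor Q_i\big)\Big)\cdot\chi^u,\qquad X=X(L)=\mathrm{Spec}\,A(L),$$ where $X(L)$ is assumed to be an affine rational complexity-one $T$-variety, i.e. normal (as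 is the case when the $Q_i$ are pairwise distinct). Let $e_1,\dots,e_m$ be the standard basis of $\mathbb{Q}^m$, $e_0=-\sum_{i\ge1}e_i$, $C\subset N_\mathbb{Q}\times\mathbb{Q}^m$ the cone generated by $\sigma\times0$ and all $\Delta_i\times e_i$. The map $\chi^{(u,v)}\mapsto z^v|_L\,\chi^u$ is a surjection $\mathbb{K}[C^\vee\cap(M\times\mathbb{Z}^m)]\to A(L)$. Fix a finite generating set $H$ of the semigroup $C^\vee\cap(M\times\mathbb{Z}^m)$; the semi-canonical generators of $A(L)$ are the images of $\chi^h$, $h\in H$. Let $\Gamma$ be a totally ordered finitely generated free abelian group, $\psi:M\to\Gamma$ a homomorphism, $Q\in L$, $\gamma\in\Gamma$ with $\gamma\ge0$. The valuation $\mathfrak{v}_{(\psi,Q,\gamma)}:R_X\setminus\{0\}\to\Gamma$ is given on homogeneous elements by $f\cdot\chi^u\mapsto\psi(u)+\mathrm{ord}_Q(f)\cdot\gamma$ ($f\in\mathbb{K}(L)^*$, $u\in M$) and on general elements by the minimum over nonzero homogeneous components. The value semigroup $S(R_X,\mathfrak{v})$ is the image of $\mathfrak{v}$; $\mathfrak{v}$ has full rank if the rank of the group generated by $S(R_X,\mathfrak{v})$ equals $\dim R_X$; a Khovanskii basis for a full rank $\mathfrak{v}$ is a subset of $R_X$ whose image under $\mathfrak{v}$ generates $S(R_X,\mathfrak{v})$. *)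

theory Defs
  imports
    "HOL-Algebra.Ideal"
    "HOL-Computational_Algebra.Polynomial"
    "HOL-Computational_Algebra.Fraction_Field"
    "HOL-Library.Poly_Mapping"
    "HOL-Library.Extended"
    "HOL-Library.Extended_Nat"
    "HOL-Library.Function_Algebras"
    "HOL-Library.Product_Plus"
    "HOL-Library.Set_Algebras"
begin

section \<open>Semigroups, lattices and rank\<close>

text \<open>As usual for affine semigroups, a semigroup has a neutral element, and the
  sub-semigroup generated by a set contains it.\<close>

inductive_set semigroup_gen :: "'a::comm_monoid_add set \<Rightarrow> 'a set" for B where
  zero: "0 \<in> semigroup_gen B"
| base: "x \<in> B \<Longrightarrow> x \<in> semigroup_gen B"
| add: "x \<in> semigroup_gen B \<Longrightarrow> y \<in> semigroup_gen B \<Longrightarrow> x + y \<in> semigroup_gen B"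

definition zscale :: "int \<Rightarrow> 'a::ab_group_add \<Rightarrow> 'a" where
  "zscale k x = (if 0 \<le> k then ((+) x ^^ nat k) 0 else - ((+) x ^^ nat (- k)) 0)"

lemma funpow_plus_add:
  "((+) (x::'a::ab_group_add) ^^ (m + n)) 0 = ((+) x ^^ m) 0 + ((+) x ^^ n) 0"
  by (induction m) (simp_all add: add.assoc)

lemma zscale_diff:
  "zscale (int m - int n) (x::'a::ab_group_add) = ((+) x ^^ m) 0 - ((+) x ^^ n) 0"
proof (cases "n \<le> m")
  case True
  then obtain d where "m = n + d" using le_Suc_ex by blast
  then show ?thesis by (simp add: zscale_def funpow_plus_add)
next
  case False
  then obtain d where d: "n = m + d" using le_Suc_ex nat_le_linear by blast
  with False have "d > 0" by simp
  with d show ?thesis by (simp add: zscale_def funpow_plus_add)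
qed

lemma zscale_add_left: "zscale (k + l) (x::'a::ab_group_add) = zscale k x + zscale l x"
proof -
  obtain a b where k: "k = int a - int b" by (metis int_diff_cases)
  obtain c d where l: "l = int c - int d" by (metis int_diff_cases)
  have "k + l = int (a + c) - int (b + d)" by (simp add: k l)
  then have "zscale (k + l) x = ((+) x ^^ (a + c)) 0 - ((+) x ^^ (b + d)) 0"
    by (simp only: zscale_diff)
  then show ?thesis by (simp add: k l zscale_diff funpow_plus_add)
qed

lemma zscale_0_left [simp]: "zscale 0 (x::'a::ab_group_add) = 0"
  by (simp add: zscale_def)

lemma zscale_1_left [simp]: "zscale 1 (x::'a::ab_group_add) = x"
  by (simp add: zscale_def)

lemma zscale_minus_left: "zscale (- k) (x::'a::ab_group_add) = - zscale k x"
  using zscale_add_left[of k "- k" x] by (simp add: eq_neg_iff_add_eq_0 add.commute)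

lemma zscale_add_right: "zscale k (x + y::'a::ab_group_add) = zscale k x + zscale k y"
proof -
  have "((+) (x + y) ^^ n) 0 = ((+) x ^^ n) 0 + ((+) y ^^ n) 0" for n
    by (induction n) (simp_all add: algebra_simps)
  then show ?thesis by (simp add: zscale_def)
qed

lemma zscale_zscale: "zscale k (zscale l (x::'a::ab_group_add)) = zscale (k * l) x"
proof (induction k rule: int_induct[where k = 0])
  case (step1 i)
  then show ?case by (simp add: zscale_add_left distrib_right)
next
  case (step2 i)
  then show ?case
    using zscale_add_left[of "i - 1" 1 "zscale l x"] zscale_add_left[of "(i - 1) * l" l x]
    by (simp add: left_diff_distrib)
qed simp

text \<open>Abelian groups as \<open>\<int>\<close>-modules; \<open>zmod.span S\<close> is the subgroup generated by \<open>S\<close>.\<close>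

global_interpretation zmod: module "zscale :: int \<Rightarrow> 'a::ab_group_add \<Rightarrow> 'a"
  by unfold_locales (simp_all add: zscale_add_right zscale_add_left zscale_zscale)

definition fg_free_abelian :: "'a::ab_group_add set \<Rightarrow> bool" where
  "fg_free_abelian G \<longleftrightarrow> (\<exists>B. finite B \<and> \<not> zmod.dependent B \<and> zmod.span B = G)"

definition group_rank :: "'a::ab_group_add set \<Rightarrow> enat" where
  "group_rank G = (SUP B \<in> {B. finite B \<and> B \<subseteq> G \<and> \<not> zmod.dependent B}. enat (card B))"

section \<open>Polyhedra in \<open>N\<^sub>\<rat>\<close>\<close>

text \<open>The character lattice \<open>M\<close> is the whole type \<open>'m\<close> (assumed free of finite rank where
  it is used), \<open>N\<^sub>\<rat> = Hom(M, \<rat>)\<close>, and the pairing of \<open>v\<close> and \<open>u\<close> is \<open>v u\<close>.\<close>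

definition NQ :: "('m::ab_group_add \<Rightarrow> rat) set" where
  "NQ = {v. additive v}"

definition polyhedron :: "('m::ab_group_add \<Rightarrow> rat) set \<Rightarrow> bool" where
  "polyhedron D \<longleftrightarrow>
    (\<exists>F :: ('m \<times> rat) set. finite F \<and> D = {v \<in> NQ. \<forall>(u, c) \<in> F. c \<le> v u})"

definition polyhedral_cone :: "('m::ab_group_add \<Rightarrow> rat) set \<Rightarrow> bool" where
  "polyhedral_cone \<sigma> \<longleftrightarrow> (\<exists>F. finite F \<and> \<sigma> = {v \<in> NQ. \<forall>u \<in> F. 0 \<le> v u})"

definition pointed :: "('m::ab_group_add \<Rightarrow> rat) set \<Rightarrow> bool" where
  "pointed \<sigma> \<longleftrightarrow> \<sigma> \<inter> {v. - v \<in> \<sigma>} = {0}"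

definition tailcone :: "('m::ab_group_add \<Rightarrow> rat) set \<Rightarrow> ('m \<Rightarrow> rat) set" where
  "tailcone D = {v \<in> NQ. \<forall>x \<in> D. x + v \<in> D}"

text \<open>The lattice points \<open>\<sigma>\<^sup>\<or> \<inter> M\<close> of the dual cone.\<close>

definition dual_lattice :: "('m::ab_group_add \<Rightarrow> rat) set \<Rightarrow> 'm set" where
  "dual_lattice \<sigma> = {u. \<forall>v \<in> \<sigma>. 0 \<le> v u}"

definition poly_eval :: "('m \<Rightarrow> rat) set \<Rightarrow> 'm \<Rightarrow> rat extended" where
  "poly_eval D u = (if D = {} then Pinf else Fin (LEAST x. x \<in> (\<lambda>v. v u) ` D))"

section \<open>The cone \<open>C\<close>\<close>

text \<open>\<open>\<int>\<^sup>m\<close> and \<open>\<rat>\<^sup>m\<close> consist of functions on \<open>nat\<close> vanishing outside \<open>{1..m}\<close>.\<close>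

definition std_vec :: "nat \<Rightarrow> nat \<Rightarrow> nat \<Rightarrow> rat" where
  "std_vec m i = (if i = 0 then (\<lambda>j. if j \<in> {1..m} then - 1 else 0)
                  else (\<lambda>j. if j = i then 1 else 0))"

inductive_set cone_gen ::
  "(('m \<Rightarrow> rat) \<times> (nat \<Rightarrow> rat)) set \<Rightarrow> (('m \<Rightarrow> rat) \<times> (nat \<Rightarrow> rat)) set" for S where
  zero: "0 \<in> cone_gen S"
| base: "p \<in> S \<Longrightarrow> p \<in> cone_gen S"
| add: "p \<in> cone_gen S \<Longrightarrow> q \<in> cone_gen S \<Longrightarrow> p + q \<in> cone_gen S"
| scale: "(x, w) \<in> cone_gen S \<Longrightarrow> 0 \<le> c \<Longrightarrow> (\<lambda>u. c * x u, \<lambda>i. c * w i) \<in> cone_gen S"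

definition cone_C :: "nat \<Rightarrow> ('m \<Rightarrow> rat) set \<Rightarrow> (nat \<Rightarrow> ('m \<Rightarrow> rat) set) \<Rightarrow>
    (('m \<Rightarrow> rat) \<times> (nat \<Rightarrow> rat)) set" where
  "cone_C m \<sigma> \<Delta> = cone_gen (\<sigma> \<times> {0} \<union> (\<Union>i\<le>m. \<Delta> i \<times> {std_vec m i}))"

text \<open>The lattice points \<open>C\<^sup>\<or> \<inter> (M \<times> \<int>\<^sup>m)\<close>.\<close>

definition dual_lattice_prod ::
    "nat \<Rightarrow> (('m \<Rightarrow> rat) \<times> (nat \<Rightarrow> rat)) set \<Rightarrow> ('m \<times> (nat \<Rightarrow> int)) set" where
  "dual_lattice_prod m C =
    {(u, v). (\<forall>i. i \<notin> {1..m} \<longrightarrow> v i = 0) \<and>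
             (\<forall>(x, w) \<in> C. 0 \<le> x u + (\<Sum>i=1..m. of_int (v i) * w i))}"

section \<open>The line \<open>L\<close>\<close>

text \<open>Two vectors \<open>a, b\<close> of \<open>\<bbbK>\<^sup>m\<^sup>+\<^sup>1\<close> (indexed by \<open>{0..m}\<close>) that are linearly independent span
  a line \<open>L\<close> in \<open>\<bbbP>\<^sup>m\<close>, and every line arises so.  We identify \<open>L\<close> with \<open>\<bbbP>\<^sup>1\<close> through
  \<open>c \<mapsto> [a + c b]\<close>, \<open>\<infinity> \<mapsto> [b]\<close>: the points of \<open>L\<close> are \<open>Some c\<close> and \<open>None\<close>, the function
  field \<open>\<bbbK>(L)\<close> is \<open>\<bbbK>(t)\<close>, that is \<open>'k poly fract\<close>, and \<open>y\<^sub>i\<close> restricts to \<open>a\<^sub>i + b\<^sub>i t\<close>.\<close>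

definition spans_line :: "nat \<Rightarrow> (nat \<Rightarrow> 'k::field) \<Rightarrow> (nat \<Rightarrow> 'k) \<Rightarrow> bool" where
  "spans_line m a b \<longleftrightarrow>
    (\<forall>s t. (\<forall>i\<le>m. s * a i + t * b i = 0) \<longrightarrow> s = 0 \<and> t = 0)"

definition hom_coord :: "(nat \<Rightarrow> 'k::field) \<Rightarrow> (nat \<Rightarrow> 'k) \<Rightarrow> 'k option \<Rightarrow> nat \<Rightarrow> 'k" where
  "hom_coord a b P i = (case P of Some c \<Rightarrow> a i + c * b i | None \<Rightarrow> b i)"

text \<open>\<open>L\<^sup>\<circ>\<close>, the intersection with the dense torus.\<close>

definition line_torus :: "nat \<Rightarrow> (nat \<Rightarrow> 'k::field) \<Rightarrow> (nat \<Rightarrow> 'k) \<Rightarrow> 'k option set" where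
  "line_torus m a b = {P. \<forall>i\<le>m. hom_coord a b P i \<noteq> 0}"

text \<open>The point \<open>Q\<^sub>i\<close> of \<open>L\<close> on which \<open>y\<^sub>i\<close> vanishes; it is unique, and \<open>V(y\<^sub>i)\<close> restricts to
  it with multiplicity one, as soon as \<open>y\<^sub>i\<close> is not identically zero on \<open>L\<close>.\<close>

definition hyper_pt :: "(nat \<Rightarrow> 'k::field) \<Rightarrow> (nat \<Rightarrow> 'k) \<Rightarrow> nat \<Rightarrow> 'k option" where
  "hyper_pt a b i = (THE P. hom_coord a b P i = 0)"

lemma hom_coord_eq_0_iff:
  assumes "hom_coord a b P' i \<noteq> 0"
  shows "hom_coord a b P i = 0 \<longleftrightarrow> P = hyper_pt a b i"
proof -
  have ex1: "\<exists>!P. hom_coord a b P i = 0"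
  proof (cases "b i = 0")
    case True
    then have "a i \<noteq> 0" using assms by (auto simp: hom_coord_def split: option.splits)
    with True show ?thesis
      by (intro ex1I[of _ None]) (auto simp: hom_coord_def split: option.splits)
  next
    case False
    then show ?thesis
      by (intro ex1I[of _ "Some (- a i / b i)"])
        (auto simp: hom_coord_def field_simps add_eq_0_iff split: option.splits)
  qed
  have "hom_coord a b (hyper_pt a b i) i = 0"
    unfolding hyper_pt_def by (rule theI'[OF ex1])
  with ex1 show ?thesis by blast
qed

text \<open>The order of vanishing at a point of \<open>\<bbbP>\<^sup>1\<close>, first of polynomials, then of rational
  functions; it is only meaningful for nonzero functions.\<close>

definition poly_ord :: "'k::field option \<Rightarrow> 'k poly \<Rightarrow> int" where
  "poly_ord P p =
    (case P of Some c \<Rightarrow> int (Polynomial.order c p) | None \<Rightarrow> - int (Polynomial.degree p))"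

definition ord_at :: "'k::field option \<Rightarrow> 'k poly fract \<Rightarrow> int" where
  "ord_at P f =
    (THE k. \<exists>p q. p \<noteq> 0 \<and> q \<noteq> 0 \<and> f = Fract p q \<and> k = poly_ord P p - poly_ord P q)"

lemma poly_ord_mult: "p \<noteq> 0 \<Longrightarrow> q \<noteq> 0 \<Longrightarrow> poly_ord P (p * q) = poly_ord P p + poly_ord P q"
  by (cases P) (simp_all add: poly_ord_def order_mult degree_mult_eq)

lemma ord_at_Fract:
  assumes "p \<noteq> 0" "q \<noteq> 0"
  shows "ord_at P (Fract p q) = poly_ord P p - poly_ord P q"
  unfolding ord_at_def
proof (rule the_equality)
  fix k
  assume "\<exists>p' q'. p' \<noteq> 0 \<and> q' \<noteq> 0 \<and> Fract p q = Fract p' q' \<and> k = poly_ord P p' - poly_ord P q'"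
  then obtain p' q' where *: "p' \<noteq> 0" "q' \<noteq> 0" "Fract p q = Fract p' q'"
    "k = poly_ord P p' - poly_ord P q'" by blast
  then have "p * q' = p' * q" using assms by (simp add: eq_fract)
  then have "poly_ord P (p * q') = poly_ord P (p' * q)" by simp
  then have "poly_ord P p + poly_ord P q' = poly_ord P p' + poly_ord P q"
    using assms * by (simp add: poly_ord_mult)
  then show "k = poly_ord P p - poly_ord P q" using * by simp
next
  show "\<exists>p' q'. p' \<noteq> 0 \<and> q' \<noteq> 0 \<and> Fract p q = Fract p' q' \<and>
      poly_ord P p - poly_ord P q = poly_ord P p' - poly_ord P q'"
    by (intro exI[of _ p] exI[of _ q]) (simp add: assms)
qed

text \<open>\<open>H\<^sup>0(L, \<O>(D))\<close>, where \<open>D\<close> may have coefficients \<open>\<infinity>\<close>.\<close>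

definition global_sections :: "('k::field option \<Rightarrow> int extended) \<Rightarrow> 'k poly fract set" where
  "global_sections D = {f. f \<noteq> 0 \<longrightarrow> (\<forall>P. 0 \<le> Fin (ord_at P f) + D P)}"

section \<open>The ring \<open>A(L)\<close>\<close>

text \<open>The divisor \<open>\<Sum>\<^sub>i \<lfloor>\<Delta>\<^sub>i(u)\<rfloor> Q\<^sub>i\<close>.\<close>

definition divisor_at :: "nat \<Rightarrow> (nat \<Rightarrow> ('m \<Rightarrow> rat) set) \<Rightarrow> (nat \<Rightarrow> 'k::field) \<Rightarrow>
    (nat \<Rightarrow> 'k) \<Rightarrow> 'm \<Rightarrow> 'k option \<Rightarrow> int extended" where
  "divisor_at m \<Delta> a b u P =
    (\<Sum>i\<le>m. if P = hyper_pt a b i then map_extended floor (poly_eval (\<Delta> i) u) else 0)"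

text \<open>\<open>A(L)\<close> is a subring of \<open>\<bbbK>(L)[M]\<close>; the latter is the type of finitely supported
  functions from \<open>M\<close> to \<open>\<bbbK>(L)\<close> with the convolution product, and \<open>f \<cdot> \<chi>\<^sup>u\<close> is
  \<open>Poly_Mapping.single u f\<close>.\<close>

definition A_L :: "nat \<Rightarrow> ('m::ab_group_add \<Rightarrow> rat) set \<Rightarrow> (nat \<Rightarrow> ('m \<Rightarrow> rat) set) \<Rightarrow>
    (nat \<Rightarrow> 'k::field) \<Rightarrow> (nat \<Rightarrow> 'k) \<Rightarrow> ('m \<Rightarrow>\<^sub>0 'k poly fract) set" where
  "A_L m \<sigma> \<Delta> a b =
    {F. Poly_Mapping.keys F \<subseteq> dual_lattice \<sigma> \<and>
        (\<forall>u \<in> dual_lattice \<sigma>. Poly_Mapping.lookup F u \<in> global_sections (divisor_at m \<Delta> a b u))}"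

definition z_fun :: "(nat \<Rightarrow> 'k::field) \<Rightarrow> (nat \<Rightarrow> 'k) \<Rightarrow> nat \<Rightarrow> 'k poly fract" where
  "z_fun a b i = Fract [:a i, b i:] [:a 0, b 0:]"

text \<open>The map \<open>\<chi>\<^bsup>(u,v)\<^esup> \<mapsto> z\<^sup>v|\<^sub>L \<chi>\<^sup>u\<close>.\<close>

definition monomial_map :: "nat \<Rightarrow> (nat \<Rightarrow> 'k::field) \<Rightarrow> (nat \<Rightarrow> 'k) \<Rightarrow>
    'm \<times> (nat \<Rightarrow> int) \<Rightarrow> ('m \<Rightarrow>\<^sub>0 'k poly fract)" where
  "monomial_map m a b h =
    Poly_Mapping.single (fst h) (\<Prod>i=1..m. z_fun a b i powi snd h i)"

section \<open>Normality and dimension\<close>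

definition subring_of :: "'a::comm_ring_1 set \<Rightarrow> 'a ring" where
  "subring_of A = \<lparr>carrier = A, monoid.mult = (*), one = 1, zero = 0, add = (+)\<rparr>"

text \<open>A domain \<open>A\<close> is normal if every element \<open>p/q\<close> of its field of fractions that is integral
  over \<open>A\<close> lies in \<open>A\<close>.  The monic equation of degree \<open>n\<close> satisfied by \<open>p/q\<close> is written
  multiplied by \<open>q\<^sup>n\<close>.\<close>

definition integral_fraction :: "'a::comm_ring_1 set \<Rightarrow> 'a \<Rightarrow> 'a \<Rightarrow> bool" where
  "integral_fraction A p q \<longleftrightarrow>
    (\<exists>n>0. \<exists>c. (\<forall>i<n. c i \<in> A) \<and> p ^ n + (\<Sum>i<n. c i * p ^ i * q ^ (n - i)) = 0)"

definition normal_domain :: "'a::comm_ring_1 set \<Rightarrow> bool" where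
  "normal_domain A \<longleftrightarrow> domain (subring_of A) \<and>
    (\<forall>p \<in> A. \<forall>q \<in> A - {0}. integral_fraction A p q \<longrightarrow> (\<exists>r \<in> A. p = r * q))"

definition krull_dim :: "('a, 'b) ring_scheme \<Rightarrow> enat" where
  "krull_dim R =
    (SUP ps \<in> {ps. ps \<noteq> [] \<and> (\<forall>I \<in> set ps. primeideal I R) \<and> sorted_wrt (\<subset>) ps}.
       enat (length ps - 1))"

section \<open>Valuations and Khovanskii bases\<close>

definition val :: "('m \<Rightarrow> 'g::linordered_ab_group_add) \<Rightarrow> 'k::field option \<Rightarrow> 'g \<Rightarrow>
    ('m \<Rightarrow>\<^sub>0 'k poly fract) \<Rightarrow> 'g" where
  "val \<psi> Q \<gamma> F = Min ((\<lambda>u. \<psi> u + zscale (ord_at Q (Poly_Mapping.lookup F u)) \<gamma>) ` Poly_Mapping.keys F)"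

definition value_semigroup :: "'a::comm_ring_1 set \<Rightarrow> ('a \<Rightarrow> 'g) \<Rightarrow> 'g set" where
  "value_semigroup R v = v ` (R - {0})"

definition full_rank :: "'a::comm_ring_1 set \<Rightarrow> ('a \<Rightarrow> 'g::ab_group_add) \<Rightarrow> bool" where
  "full_rank R v \<longleftrightarrow> group_rank (zmod.span (value_semigroup R v)) = krull_dim (subring_of R)"

text \<open>As \<open>v\<close> is not defined at \<open>0\<close>, a Khovanskii basis consists of nonzero elements.\<close>

definition khovanskii_basis ::
    "'a::comm_ring_1 set \<Rightarrow> ('a \<Rightarrow> 'g::ab_group_add) \<Rightarrow> 'a set \<Rightarrow> bool" where
  "khovanskii_basis R v B \<longleftrightarrow>
    full_rank R v \<and> B \<subseteq> R - {0} \<and> semigroup_gen (v ` B) = value_semigroup R v"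

end

theory Submission
  imports Defs
begin

text \<open>The valuation of a nonzero element of \<open>A(L)\<close> is that of one of its homogeneous components
  \<open>f \<chi>\<^sup>u\<close>, hence it is determined by \<open>u\<close> and \<open>ord\<^sub>Q f\<close>.  The idea is that, for a point \<open>Q\<close>
  outside the torus, every order at \<open>Q\<close> of a section of degree \<open>u\<close> is already the order of a
  monomial \<open>z\<^sup>v\<close> with \<open>(u, v)\<close> in \<open>C\<^sup>\<or>\<close>.  The value semigroup is therefore the image of
  \<open>C\<^sup>\<or> \<inter> (M \<times> \<int>\<^sup>m)\<close> under the additive map \<open>(u, v) \<mapsto> \<psi>(u) + ord\<^sub>Q(z\<^sup>v) \<gamma>\<close>, and such an image is
  generated by the images of the generators \<open>H\<close>.

  To find \<open>v\<close>, write \<open>z\<^sup>v\<close> as the degree-zero monomial \<open>\<Prod>\<^sub>i y\<^sub>i\<^bsup>v\<^sub>i\<^esup>\<close> in \<open>y\<^sub>0, \<dots>, y\<^sub>m\<close>.  Its divisor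
  on \<open>L\<close> is \<open>\<Sum>\<^sub>i v\<^sub>i Q\<^sub>i\<close>, and \<open>(u, v)\<close> lies in \<open>C\<^sup>\<or>\<close> iff \<open>u\<close> lies in \<open>\<sigma>\<^sup>\<or>\<close> and
  \<open>v\<^sub>i + \<lfloor>\<Delta>\<^sub>i(u)\<rfloor> \<ge> 0\<close> for all \<open>i\<close>
  (\<open>dual_lattice_prod_cone_C\<close>, \<open>eval_floor_ge_iff\<close>).  Thus one needs integers \<open>v\<^sub>i\<close> bounded below
  by \<open>-\<lfloor>\<Delta>\<^sub>i(u)\<rfloor>\<close> such that those with \<open>Q\<^sub>i = Q\<close> add up to \<open>k = ord\<^sub>Q f\<close> and the remaining ones add
  up to \<open>-k\<close>.  Both index sets are nonempty, the first because \<open>Q\<close> is not in the torus, the second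
  because the coordinates of a line cannot all vanish at one point.  So the only
  obstruction is that the lower bounds add up to too much.  For the first set this is excluded by
  the condition on \<open>f\<close> at \<open>Q\<close>; for the second by the conditions at the other points together with
  the fact that a principal divisor on the projective line has degree zero
  (\<open>sum_ord_at_le_0\<close>).  This is \<open>section_order_realised_by_monomial\<close>.

  The inequality \<open>\<langle>x, u\<rangle> + v\<^sub>i \<ge> 0\<close> for all \<open>x\<close> in \<open>\<Delta>\<^sub>i\<close> can be expressed through \<open>\<Delta>\<^sub>i(u)\<close> since
  a linear functional that is nonnegative on the tail cone of a nonempty polyhedron attains its minimum on it
  (\<open>polyhedron_min_attained\<close>).\<close>

section \<open>Linear functionals attain their minimum on a polyhedron\<close>

lemma NQ_affine_comb: "x \<in> NQ \<Longrightarrow> d \<in> NQ \<Longrightarrow> (\<lambda>t. x t + s * d t) \<in> NQ"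
  by (auto simp: NQ_def additive_def algebra_simps)

lemma NQ_combs:
  "x \<in> NQ \<Longrightarrow> d \<in> NQ \<Longrightarrow> x + d \<in> NQ"
  "x \<in> NQ \<Longrightarrow> - x \<in> NQ"
  "x \<in> NQ \<Longrightarrow> d \<in> NQ \<Longrightarrow> x - d \<in> NQ"
  by (auto simp: NQ_def additive_def algebra_simps)

text \<open>If the functional is not constant on the affine subspace given by the tight inequalities of a
  point \<open>x\<close> (those that are equalities at \<open>x\<close>), one can walk from \<open>x\<close> inside this subspace so that
  the functional decreases.  The direction is not in the tail cone, where the functional is
  nonnegative, so at some point a further inequality becomes tight.  There are finitely
  many inequalities, hence every point is dominated by one where the functional is constant on the
  affine subspace.  The value at such a point depends only on the set of tight inequalities, so only
  finitely many values compete for the minimum.\<close>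

lemma polyhedron_min_attained:
  fixes D :: "('m::ab_group_add \<Rightarrow> rat) set"
  assumes "polyhedron D" "D \<noteq> {}" "u \<in> dual_lattice (tailcone D)"
  shows "\<exists>x\<in>D. \<forall>y\<in>D. x u \<le> y u"
proof -
  obtain F :: "('m \<times> rat) set" where F: "finite F" and D: "D = {v \<in> NQ. \<forall>(w, c) \<in> F. c \<le> v w}"
    using assms(1) unfolding polyhedron_def by blast
  define T where "T x = {(w, c) \<in> F. x w = c}" for x :: "'m \<Rightarrow> rat"
  \<comment> \<open>\<open>u\<close> is constant along the directions that keep the tight inequalities of \<open>x\<close> tight.\<close>
  define flat where "flat x \<longleftrightarrow> (\<forall>d\<in>NQ. (\<forall>(w, c) \<in> T x. d w = 0) \<longrightarrow> d u = 0)" for x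
  have TF: "T x \<subseteq> F" for x by (auto simp: T_def)
  have descend: "\<exists>y\<in>D. flat y \<and> y u \<le> x u" if "x \<in> D" for x
    using that
  proof (induction "card (F - T x)" arbitrary: x rule: less_induct)
    case less
    show ?case
    proof (cases "flat x")
      case True
      with less.prems show ?thesis by blast
    next
      case False
      then obtain d0 where d0: "d0 \<in> NQ" "\<forall>(w, c) \<in> T x. d0 w = 0" "d0 u \<noteq> 0"
        by (auto simp: flat_def)
      define d where "d = (if d0 u < 0 then d0 else - d0)"
      have d: "d \<in> NQ" "\<forall>(w, c) \<in> T x. d w = 0" "d u < 0"
        using d0 NQ_combs(2)[of d0] by (auto simp: d_def)
      define B where "B = {(w, c) \<in> F. d w < 0}"
      have "B \<noteq> {}"
      proof
        assume "B = {}"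
        then have *: "0 \<le> d w" if "(w, c) \<in> F" for w c using that by (force simp: B_def)
        have "y + d \<in> D" if "y \<in> D" for y
        proof -
          have "c \<le> y w + d w" if "(w, c) \<in> F" for w c
            using \<open>y \<in> D\<close> *[OF that] that by (fastforce simp: D)
          then show ?thesis using that d(1) NQ_combs(1)[of y d] by (auto simp: D)
        qed
        then have "d \<in> tailcone D" using d(1) by (simp add: tailcone_def)
        with assms(3) d(3) show False by (force simp: dual_lattice_def)
      qed
      have "finite B" using F by (rule rev_finite_subset) (auto simp: B_def)
      \<comment> \<open>The largest step along \<open>d\<close> that stays inside \<open>D\<close>: there the first of the
        inequalities that \<open>d\<close> decreases becomes an equality.\<close>
      define s where "s = Min ((\<lambda>(w, c). (x w - c) / (- d w)) ` B)"
      have s_le: "s \<le> (x w - c) / (- d w)" if "(w, c) \<in> B" for w c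
        unfolding s_def by (rule Min_le) (use \<open>finite B\<close> that in auto)
      have "s \<in> (\<lambda>(w, c). (x w - c) / (- d w)) ` B"
        unfolding s_def by (rule Min_in) (use \<open>finite B\<close> \<open>B \<noteq> {}\<close> in auto)
      then obtain w0 c0 where wc0: "(w0, c0) \<in> B" "s = (x w0 - c0) / (- d w0)" by auto
      have B0: "(w0, c0) \<in> F" "d w0 < 0" using wc0 by (auto simp: B_def)
      have "c0 \<le> x w0" using B0 less.prems by (auto simp: D)
      then have s0: "0 \<le> s" using B0 by (simp add: wc0(2) divide_nonneg_neg)
      define y where "y = (\<lambda>t. x t + s * d t)"
      have "c \<le> y w" if wc: "(w, c) \<in> F" for w c
      proof (cases "d w < 0")
        case True
        then have "s \<le> (x w - c) / (- d w)" using wc by (intro s_le) (auto simp: B_def)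
        then show ?thesis using True by (simp add: y_def field_simps)
      next
        case False
        then have "0 \<le> s * d w" using s0 by simp
        moreover have "c \<le> x w" using wc less.prems by (auto simp: D)
        ultimately show ?thesis by (simp add: y_def)
      qed
      then have yD: "y \<in> D"
        using less.prems d(1) NQ_affine_comb[of x d s] by (auto simp: D y_def)
      have "T x \<subseteq> T y" using d(2) by (auto simp: T_def y_def)
      moreover have "(w0, c0) \<in> T y" using B0 by (simp add: T_def y_def wc0(2))
      moreover have "(w0, c0) \<notin> T x" using d(2) B0 by auto
      ultimately have "F - T y \<subset> F - T x" using B0 by blast
      then have "card (F - T y) < card (F - T x)" using F by (intro psubset_card_mono) auto
      from less.hyps[OF this yD] obtain z where "z \<in> D" "flat z" "z u \<le> y u" by blast
      moreover have "y u \<le> x u" using s0 d(3) by (simp add: y_def mult_nonneg_nonpos)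
      ultimately show ?thesis by (meson order_trans)
    qed
  qed
  define A where "A = {y \<in> D. flat y}"
  have same: "y u = y' u" if "y \<in> A" "y' \<in> A" "T y = T y'" for y y'
  proof -
    have "\<forall>(w, c) \<in> T y. (y - y') w = 0" using that(3) by (auto simp: T_def)
    moreover have "y - y' \<in> NQ" using that NQ_combs(3)[of y y'] by (auto simp: A_def D)
    moreover have "flat y" using that(1) by (simp add: A_def)
    ultimately have "(y - y') u = 0" unfolding flat_def by blast
    then show ?thesis by simp
  qed
  have "finite ((\<lambda>y. y u) ` A)"
  proof (rule finite_surj)
    show "finite (T ` A)" using F TF by (meson finite_Pow_iff finite_subset image_subsetI PowI)
    show "(\<lambda>y. y u) ` A \<subseteq> (\<lambda>S. (SOME y. y \<in> A \<and> T y = S) u) ` (T ` A)"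
    proof (rule image_subsetI)
      fix y assume "y \<in> A"
      then have "(SOME y'. y' \<in> A \<and> T y' = T y) \<in> A \<and> T (SOME y'. y' \<in> A \<and> T y' = T y) = T y"
        by (intro someI[of "\<lambda>y'. y' \<in> A \<and> T y' = T y" y]) simp
      then have "y u = (SOME y'. y' \<in> A \<and> T y' = T y) u"
        using \<open>y \<in> A\<close> by (intro same) auto
      with \<open>y \<in> A\<close> show "y u \<in> (\<lambda>S. (SOME y. y \<in> A \<and> T y = S) u) ` (T ` A)" by blast
    qed
  qed
  moreover have "A \<noteq> {}" using descend assms(2) by (auto simp: A_def)
  ultimately have "Min ((\<lambda>y. y u) ` A) \<in> (\<lambda>y. y u) ` A" by (intro Min_in) auto
  then obtain x where "x \<in> A" "Min ((\<lambda>y. y u) ` A) = x u" by blast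
  with \<open>finite ((\<lambda>y. y u) ` A)\<close> have x: "x \<in> A" "\<forall>y\<in>A. x u \<le> y u"
    by (auto simp flip: \<open>Min ((\<lambda>y. y u) ` A) = x u\<close>)
  have "x u \<le> y u" if y: "y \<in> D" for y
  proof -
    obtain z where "z \<in> D" "flat z" "z u \<le> y u" using descend[OF y] by blast
    moreover from this have "x u \<le> z u" using x(2) by (simp add: A_def)
    ultimately show ?thesis by linarith
  qed
  with x(1) show ?thesis by (auto simp: A_def)
qed

definition eval_floor :: "('m \<Rightarrow> rat) set \<Rightarrow> 'm \<Rightarrow> int extended" where
  "eval_floor D u = map_extended floor (poly_eval D u)"

lemma eval_floor_cases:
  assumes "D = {} \<or> polyhedron D \<and> tailcone D = \<sigma>" "u \<in> dual_lattice \<sigma>"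
  obtains "D = {}" "eval_floor D u = Pinf"
  | l where "eval_floor D u = Fin l" "\<And>n. (\<forall>x\<in>D. 0 \<le> x u + of_int n) \<longleftrightarrow> 0 \<le> n + l"
proof (cases "D = {}")
  case True
  then show ?thesis using that(1) by (simp add: eval_floor_def poly_eval_def)
next
  case False
  then obtain x where x: "x \<in> D" "\<forall>y\<in>D. x u \<le> y u"
    using polyhedron_min_attained[of D u] assms by blast
  then have "(LEAST r. r \<in> (\<lambda>v. v u) ` D) = x u"
    by (intro Least_equality) auto
  then have 1: "eval_floor D u = Fin \<lfloor>x u\<rfloor>"
    using False by (simp add: eval_floor_def poly_eval_def)
  have "(\<forall>y\<in>D. 0 \<le> y u + of_int n) \<longleftrightarrow> 0 \<le> n + \<lfloor>x u\<rfloor>" for n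
  proof -
    have "(\<forall>y\<in>D. 0 \<le> y u + of_int n) \<longleftrightarrow> 0 \<le> x u + of_int n"
      using x by (meson add_right_mono order_trans)
    also have "\<dots> \<longleftrightarrow> 0 \<le> n + \<lfloor>x u\<rfloor>" by linarith
    finally show ?thesis .
  qed
  then show ?thesis by (rule that(2)[OF 1])
qed

text \<open>Since the minimum is attained and \<open>n\<close> is an integer, rounding down loses nothing; for the empty
  polyhedron both sides hold trivially.\<close>

lemma eval_floor_ge_iff:
  assumes "D = {} \<or> polyhedron D \<and> tailcone D = \<sigma>" "u \<in> dual_lattice \<sigma>"
  shows "0 \<le> Fin n + eval_floor D u \<longleftrightarrow> (\<forall>x\<in>D. 0 \<le> x u + of_int n)"
  by (rule eval_floor_cases[OF assms]) (simp_all add: zero_extended_def)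

section \<open>The lattice points of the dual cone\<close>

text \<open>The exponents of \<open>z\<^sup>v\<close> as a monomial of degree zero in the homogeneous coordinates
  \<open>y\<^sub>0, \<dots>, y\<^sub>m\<close>: as \<open>z\<^sub>i = y\<^sub>i / y\<^sub>0\<close>, the variable \<open>y\<^sub>0\<close> has the exponent that makes the sum zero.
  This treats the index \<open>0\<close> on the same footing as the others.\<close>

definition hom_exp :: "nat \<Rightarrow> (nat \<Rightarrow> int) \<Rightarrow> nat \<Rightarrow> int" where
  "hom_exp m v i = (if i = 0 then - (\<Sum>j=1..m. v j) else v i)"

lemma atMost_split: "{..m} = insert 0 {1..m}" for m :: nat
  by auto

lemma hom_exp_add: "hom_exp m (v + w) i = hom_exp m v i + hom_exp m w i"
  by (simp add: hom_exp_def sum.distrib)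

lemma hom_exp_0: "hom_exp m 0 i = 0"
  by (simp add: hom_exp_def)

lemma hom_exp_restrict:
  assumes "(\<Sum>i\<le>m. v i) = 0" "i \<le> m"
  shows "hom_exp m (\<lambda>j. if j \<in> {1..m} then v j else 0) i = v i"
  using assms by (auto simp: hom_exp_def atMost_split)

lemma pairing_std_vec:
  assumes "i \<le> m"
  shows "(\<Sum>j=1..m. of_int (v j) * std_vec m i j) = of_int (hom_exp m v i)"
proof (cases "i = 0")
  case True
  have "(\<Sum>j=1..m. of_int (v j) * std_vec m i j) = (\<Sum>j=1..m. - of_int (v j))"
    using True by (intro sum.cong) (auto simp: std_vec_def)
  then show ?thesis using True by (simp add: hom_exp_def sum_negf)
next
  case False
  have "(\<Sum>j=1..m. of_int (v j) * std_vec m i j) = (\<Sum>j=1..m. if j = i then of_int (v j) else 0)"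
    using False by (intro sum.cong) (auto simp: std_vec_def)
  then show ?thesis using False assms by (simp add: hom_exp_def)
qed

text \<open>A linear form is nonnegative on a cone as soon as it is so on generators, and
  \<open>v\<close> pairs with \<open>e\<^sub>i\<close> to its \<open>i\<close>-th homogeneous exponent, for \<open>i = 0\<close> included.\<close>

lemma dual_lattice_prod_cone_C:
  "(u, v) \<in> dual_lattice_prod m (cone_C m \<sigma> \<Delta>) \<longleftrightarrow>
    (\<forall>i. i \<notin> {1..m} \<longrightarrow> v i = 0) \<and> u \<in> dual_lattice \<sigma> \<and>
    (\<forall>i\<le>m. \<forall>x\<in>\<Delta> i. 0 \<le> x u + of_int (hom_exp m v i))"
proof -
  define pair where "pair = (\<lambda>(x, w). x u + (\<Sum>i=1..m. of_int (v i) * w i) :: rat)"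
  have nonneg_cone_gen: "(\<forall>p\<in>cone_gen S. 0 \<le> pair p) \<longleftrightarrow> (\<forall>p\<in>S. 0 \<le> pair p)" for S
  proof
    assume S: "\<forall>p\<in>S. 0 \<le> pair p"
    have "0 \<le> pair p" if "p \<in> cone_gen S" for p
      using that
    proof induction
      case zero
      show ?case by (simp add: pair_def zero_prod_def)
    next
      case (base p)
      then show ?case using S by blast
    next
      case (add p q)
      have "pair (p + q) = pair p + pair q"
        by (simp add: pair_def split_beta algebra_simps sum.distrib)
      then show ?case using add by simp
    next
      case (scale x w c)
      have "pair (\<lambda>u. c * x u, \<lambda>i. c * w i) = c * pair (x, w)"
        by (simp add: pair_def algebra_simps sum_distrib_left)
      then show ?case using scale by simp
    qed
    then show "\<forall>p\<in>cone_gen S. 0 \<le> pair p" by blast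
  qed (auto intro: cone_gen.base)
  have "(\<forall>p\<in>cone_C m \<sigma> \<Delta>. 0 \<le> pair p) \<longleftrightarrow>
      u \<in> dual_lattice \<sigma> \<and> (\<forall>i\<le>m. \<forall>x\<in>\<Delta> i. 0 \<le> pair (x, std_vec m i))"
    unfolding cone_C_def nonneg_cone_gen
    by (auto simp: ball_Un pair_def dual_lattice_def)
  moreover have "pair (x, std_vec m i) = x u + of_int (hom_exp m v i)" if "i \<le> m" for x i
    using pairing_std_vec[OF that] by (simp add: pair_def)
  ultimately show ?thesis
    by (simp add: dual_lattice_prod_def pair_def case_prod_unfold)
qed

section \<open>Orders of rational functions on the projective line\<close>

lemma Fract_eq_0_iff: "q \<noteq> 0 \<Longrightarrow> Fract p q = 0 \<longleftrightarrow> p = 0"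
  unfolding Zero_fract_def by (subst eq_fract) auto

lemma fract_nonzeroE:
  fixes f :: "'k::field poly fract"
  assumes "f \<noteq> 0"
  obtains p q where "f = Fract p q" "p \<noteq> 0" "q \<noteq> 0"
  using assms by (cases f) (auto simp: Fract_eq_0_iff)

lemma ord_at_mult:
  assumes "f \<noteq> 0" "g \<noteq> 0"
  shows "ord_at P (f * g) = ord_at P f + ord_at P g"
proof -
  obtain p q where f: "f = Fract p q" "p \<noteq> 0" "q \<noteq> 0" using assms(1) by (rule fract_nonzeroE)
  obtain r s where g: "g = Fract r s" "r \<noteq> 0" "s \<noteq> 0" using assms(2) by (rule fract_nonzeroE)
  show ?thesis using f g by (simp add: ord_at_Fract poly_ord_mult)
qed

lemma ord_at_1: "ord_at P 1 = 0"
  by (simp add: One_fract_def ord_at_Fract)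

lemma ord_at_power: "f \<noteq> 0 \<Longrightarrow> ord_at P (f ^ n) = int n * ord_at P f"
  by (induction n) (simp_all add: ord_at_1 ord_at_mult algebra_simps)

lemma ord_at_inverse: "f \<noteq> 0 \<Longrightarrow> ord_at P (inverse f) = - ord_at P f"
  using ord_at_mult[of f "inverse f" P] by (simp add: ord_at_1)

lemma ord_at_powi: "f \<noteq> 0 \<Longrightarrow> ord_at P (f powi k) = k * ord_at P f"
  by (simp add: power_int_def ord_at_power ord_at_inverse)

lemma ord_at_prod:
  assumes "finite S" "\<And>i. i \<in> S \<Longrightarrow> f i \<noteq> 0"
  shows "ord_at P (\<Prod>i\<in>S. f i) = (\<Sum>i\<in>S. ord_at P (f i))"
  using assms by (induction S) (simp_all add: ord_at_1 ord_at_mult)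

lemma proots_prod_linear: "proots (\<Prod>x\<in>#A. [:- x, 1:]) = A"
proof (induction A)
  case (add x A)
  have "(\<Prod>x\<in>#A. [:- x, 1:]) \<noteq> 0" by (auto simp: prod_mset_zero_iff)
  then have "proots ([:- x, 1:] * (\<Prod>x\<in>#A. [:- x, 1:])) = {#x#} + A"
    using add by (subst proots_mult) auto
  then show ?case by simp
qed simp

lemma sum_order_eq_degree:
  fixes p :: "'k::alg_closed_field poly"
  assumes "p \<noteq> 0" "finite S" "{c. poly p c = 0} \<subseteq> S"
  shows "(\<Sum>c\<in>S. order c p) = degree p"
proof -
  obtain A where A: "size A = degree p" "p = smult (lead_coeff p) (\<Prod>x\<in>#A. [:- x, 1:])"
    using alg_closed_imp_factorization[OF assms(1)] by blast
  have "proots p = A"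
    using assms(1) by (subst A(2)) (simp add: proots_prod_linear)
  have "(\<Sum>c\<in>S. order c p) = (\<Sum>c | poly p c = 0. order c p)"
    using assms by (intro sum.mono_neutral_right) (auto simp: order_root)
  also have "\<dots> = size (proots p)"
    using assms(1) by (simp add: size_multiset_overloaded_eq)
  finally show ?thesis using A(1) \<open>proots p = A\<close> by simp
qed

text \<open>Over an algebraically closed field the roots account for the whole degree, and the degree is
  the pole order at \<open>\<infinity>\<close>.\<close>

lemma sum_poly_ord_eq_0:
  fixes p :: "'k::alg_closed_field poly"
  assumes "p \<noteq> 0" "finite S" "{c. poly p c = 0} \<subseteq> S"
  shows "(\<Sum>P\<in>insert None (Some ` S). poly_ord P p) = 0"
proof -
  have "(\<Sum>P\<in>Some ` S. poly_ord P p) = (\<Sum>c\<in>S. int (order c p))"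
    by (simp add: sum.reindex poly_ord_def)
  also have "\<dots> = int (degree p)"
    using sum_order_eq_degree[OF assms] by (simp flip: of_nat_sum)
  finally show ?thesis using assms(2) by (simp add: poly_ord_def)
qed

text \<open>All orders of \<open>f\<close> add up to zero, and those omitted on the left are nonnegative.\<close>

lemma sum_ord_at_le_0:
  fixes f :: "'k::alg_closed_field poly fract"
  assumes "f \<noteq> 0" "finite T" "\<And>P. P \<notin> T \<Longrightarrow> 0 \<le> ord_at P f"
  shows "(\<Sum>P\<in>T. ord_at P f) \<le> 0"
proof -
  obtain p q where f: "f = Fract p q" "p \<noteq> 0" "q \<noteq> 0" using assms(1) by (rule fract_nonzeroE)
  define S where "S = {c. poly p c = 0} \<union> {c. poly q c = 0} \<union> {c. Some c \<in> T}"
  have "{c. Some c \<in> T} = Some -` T" by auto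
  then have S: "finite S" using assms(2) f
    by (simp add: S_def poly_roots_finite finite_vimageI)
  have "(\<Sum>P\<in>T. ord_at P f) \<le> (\<Sum>P\<in>insert None (Some ` S). ord_at P f)"
  proof (rule sum_mono2)
    show "T \<subseteq> insert None (Some ` S)"
    proof
      fix P assume "P \<in> T" then show "P \<in> insert None (Some ` S)"
        by (cases P) (auto simp: S_def)
    qed
  qed (use S assms(3) in auto)
  also have "\<dots> = (\<Sum>P\<in>insert None (Some ` S). poly_ord P p) - (\<Sum>P\<in>insert None (Some ` S). poly_ord P q)"
    using f by (simp add: ord_at_Fract sum_subtractf)
  also have "\<dots> = 0"
  proof -
    have "{c. poly p c = 0} \<subseteq> S" "{c. poly q c = 0} \<subseteq> S" by (auto simp: S_def)
    then show ?thesis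
      using sum_poly_ord_eq_0[OF f(2) S] sum_poly_ord_eq_0[OF f(3) S] by simp
  qed
  finally show ?thesis .
qed

text \<open>The polynomial \<open>a\<^sub>i + b\<^sub>i t\<close> is the form \<open>y\<^sub>i\<close> divided by a form whose zero is the point \<open>\<infinity>\<close>; this
  is where the second term comes from.  It cancels in quotients of two coordinates.\<close>

lemma poly_ord_coordinate:
  fixes a b :: "nat \<Rightarrow> 'k::field"
  assumes "hom_coord a b P' i \<noteq> 0"
  shows "poly_ord P [:a i, b i:] = of_bool (P = hyper_pt a b i) - of_bool (P = None)"
proof (cases P)
  case None
  have "P = hyper_pt a b i \<longleftrightarrow> b i = 0"
    using hom_coord_eq_0_iff[OF assms, of P] None by (simp add: hom_coord_def)
  then show ?thesis using None by (simp add: poly_ord_def)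
next
  case (Some c)
  have ne: "[:a i, b i:] \<noteq> 0"
    using assms by (auto simp: hom_coord_def split: option.splits)
  have "P = hyper_pt a b i \<longleftrightarrow> poly [:a i, b i:] c = 0"
    using hom_coord_eq_0_iff[OF assms, of P] Some by (simp add: hom_coord_def)
  also have "\<dots> \<longleftrightarrow> order c [:a i, b i:] \<noteq> 0"
    using ne order_root[of "[:a i, b i:]" c] by blast
  finally have "P = hyper_pt a b i \<longleftrightarrow> order c [:a i, b i:] \<noteq> 0" .
  moreover have "order c [:a i, b i:] \<le> 1"
    using order_degree[OF ne, of c] by (simp split: if_splits)
  ultimately have "order c [:a i, b i:] = of_bool (P = hyper_pt a b i)" by auto
  then show ?thesis using Some by (simp add: poly_ord_def)
qed

section \<open>Monomials restricted to the line\<close>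

abbreviation z_mono :: "nat \<Rightarrow> (nat \<Rightarrow> 'k::field) \<Rightarrow> (nat \<Rightarrow> 'k) \<Rightarrow> (nat \<Rightarrow> int) \<Rightarrow> 'k poly fract" where
  "z_mono m a b v \<equiv> \<Prod>i=1..m. z_fun a b i powi v i"

lemma coordinate_nonzero:
  assumes "line_torus m a b \<noteq> {}" "i \<le> m"
  shows "\<exists>P. hom_coord a b P i \<noteq> 0"
  using assms by (auto simp: line_torus_def)

lemma linear_form_nonzero: "hom_coord a b P i \<noteq> 0 \<Longrightarrow> [:a i, b i:] \<noteq> 0"
  by (auto simp: hom_coord_def split: option.splits)

lemma z_fun_nonzero:
  assumes "line_torus m a b \<noteq> {}" "i \<le> m"
  shows "z_fun a b i \<noteq> 0"
proof -
  obtain P P' where P: "hom_coord a b P i \<noteq> 0" "hom_coord a b P' 0 \<noteq> 0"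
    using coordinate_nonzero[OF assms] coordinate_nonzero[OF assms(1), of 0] by blast
  show ?thesis using linear_form_nonzero[OF P(1)] linear_form_nonzero[OF P(2)]
    by (simp add: z_fun_def Fract_eq_0_iff del: pCons_eq_0_iff)
qed

lemma z_mono_nonzero:
  assumes "line_torus m a b \<noteq> {}"
  shows "z_mono m a b v \<noteq> 0"
  using z_fun_nonzero[OF assms] by simp

lemma ord_at_z_fun:
  assumes "line_torus m a b \<noteq> {}" "i \<le> m"
  shows "ord_at P (z_fun a b i) = of_bool (P = hyper_pt a b i) - of_bool (P = hyper_pt a b 0)"
proof -
  obtain R R' where "hom_coord a b R i \<noteq> 0" "hom_coord a b R' 0 \<noteq> 0"
    using coordinate_nonzero[OF assms] coordinate_nonzero[OF assms(1), of 0] by blast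
  then show ?thesis
    using linear_form_nonzero[of a b R i] linear_form_nonzero[of a b R' 0]
      poly_ord_coordinate[of a b R i P] poly_ord_coordinate[of a b R' 0 P]
    by (simp add: z_fun_def ord_at_Fract del: pCons_eq_0_iff)
qed

lemma ord_at_z_mono:
  assumes "line_torus m a b \<noteq> {}"
  shows "ord_at P (z_mono m a b v) = (\<Sum>i | i \<le> m \<and> P = hyper_pt a b i. hom_exp m v i)"
proof -
  have "ord_at P (z_mono m a b v) = (\<Sum>i=1..m. ord_at P (z_fun a b i powi v i))"
    using z_fun_nonzero[OF assms] by (subst ord_at_prod) auto
  also have "\<dots> = (\<Sum>i=1..m. v i * (of_bool (P = hyper_pt a b i) - of_bool (P = hyper_pt a b 0)))"
    using z_fun_nonzero[OF assms] ord_at_z_fun[OF assms]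
    by (intro sum.cong) (auto simp: ord_at_powi)
  also have "\<dots> = (\<Sum>i\<le>m. hom_exp m v i * of_bool (P = hyper_pt a b i))"
    by (auto simp: atMost_split hom_exp_def sum_subtractf right_diff_distrib sum_distrib_right
        intro!: sum.cong)
  also have "\<dots> = (\<Sum>i | i \<le> m \<and> P = hyper_pt a b i. hom_exp m v i)"
    by (simp add: Int_def atMost_def of_bool_def if_distrib sum.If_cases cong: if_cong)
  finally show ?thesis .
qed

section \<open>Sections of the divisors\<close>

lemma sum_extended:
  fixes d :: "'a \<Rightarrow> int extended"
  assumes "finite S" "\<And>i. i \<in> S \<Longrightarrow> d i = Pinf \<or> d i = Fin (l i)"
  shows "sum d S = (if \<exists>i\<in>S. d i = Pinf then Pinf else Fin (sum l S))"
  using assms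
proof (induction S)
  case empty
  then show ?case by (simp add: zero_extended_def)
next
  case (insert x S)
  have "sum d S = (if \<exists>i\<in>S. d i = Pinf then Pinf else Fin (sum l S))"
    using insert by blast
  then show ?case using insert(1,2) insert(4)[of x] by auto
qed

lemma divisor_at_eq:
  "divisor_at m \<Delta> a b u P = (\<Sum>i | i \<le> m \<and> P = hyper_pt a b i. eval_floor (\<Delta> i) u)"
  by (simp add: divisor_at_def eval_floor_def sum.If_cases Int_def)

text \<open>Give every index its lower bound, except for one that absorbs the rest of the sum; the latter
  is an unbounded index if there is any, and otherwise the hypothesis leaves it enough room.\<close>

lemma exists_with_sum:
  fixes d :: "'a \<Rightarrow> int extended"
  assumes "finite S" "S \<noteq> {}" "\<And>i. i \<in> S \<Longrightarrow> d i = Pinf \<or> d i = Fin (l i)"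
    and "(\<forall>i\<in>S. d i = Fin (l i)) \<Longrightarrow> 0 \<le> k + sum l S"
  shows "\<exists>v. sum v S = k \<and> (\<forall>i\<in>S. 0 \<le> Fin (v i) + d i)"
proof -
  obtain j where j: "j \<in> S" "d j = Pinf \<or> (\<forall>i\<in>S. d i = Fin (l i))"
    using assms(2,3) by blast
  define v where "v = (\<lambda>i. - l i)(j := k + sum l (S - {j}))"
  have "sum v S = v j + sum v (S - {j})" using assms(1) j(1) by (simp add: sum.remove)
  also have "sum v (S - {j}) = - sum l (S - {j})"
    by (simp add: v_def flip: sum_negf)
  finally have "sum v S = k" by (simp add: v_def)
  moreover have "0 \<le> Fin (v i) + d i" if "i \<in> S" for i
  proof (cases "i = j")
    case True
    have "d j = Pinf \<or> 0 \<le> k + sum l S \<and> d j = Fin (l j)" using j assms(4) by blast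
    then show ?thesis
      using True sum.remove[OF assms(1) j(1), of l] by (auto simp: zero_extended_def v_def)
  next
    case False
    then show ?thesis using assms(3)[OF that] by (auto simp: zero_extended_def v_def)
  qed
  ultimately show ?thesis by blast
qed

lemma not_all_hyper_pts_equal:
  assumes "spans_line m a b" "line_torus m a b \<noteq> {}"
  obtains i where "i \<le> m" "P \<noteq> hyper_pt a b i"
proof -
  have "\<exists>i\<le>m. hom_coord a b P i \<noteq> 0"
  proof (cases P)
    case None
    then show ?thesis using assms(1)[unfolded spans_line_def, rule_format, of 0 1]
      by (auto simp: hom_coord_def)
  next
    case (Some c)
    then show ?thesis using assms(1)[unfolded spans_line_def, rule_format, of 1 c]
      by (auto simp: hom_coord_def)
  qed
  then obtain i where i: "i \<le> m" "hom_coord a b P i \<noteq> 0" by blast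
  then have "P \<noteq> hyper_pt a b i" using hom_coord_eq_0_iff[of a b P i P] by auto
  with i that show ?thesis by blast
qed

lemma boundary_point_is_hyper_pt:
  assumes "line_torus m a b \<noteq> {}" "Q \<notin> line_torus m a b"
  obtains i where "i \<le> m" "Q = hyper_pt a b i"
proof -
  obtain i where i: "i \<le> m" "hom_coord a b Q i = 0" using assms(2) by (auto simp: line_torus_def)
  obtain P where "hom_coord a b P i \<noteq> 0" using coordinate_nonzero[OF assms(1) i(1)] by blast
  then show ?thesis using that i hom_coord_eq_0_iff by blast
qed

text \<open>The exponents are chosen separately for the \<open>i\<close> with \<open>Q\<^sub>i = Q\<close>, where they determine the order
  at \<open>Q\<close>, and for the other \<open>i\<close>, where they restore degree zero.\<close>

lemma section_order_realised_by_monomial: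
  fixes a b :: "nat \<Rightarrow> 'k::alg_closed_field"
  assumes line: "spans_line m a b" "line_torus m a b \<noteq> {}" and Q: "Q \<notin> line_torus m a b"
    and \<Delta>: "\<And>i. i \<le> m \<Longrightarrow> \<Delta> i = {} \<or> polyhedron (\<Delta> i) \<and> tailcone (\<Delta> i) = \<sigma>"
    and u: "u \<in> dual_lattice \<sigma>"
    and f: "f \<in> global_sections (divisor_at m \<Delta> a b u)" "f \<noteq> 0"
  shows "\<exists>v. (u, v) \<in> dual_lattice_prod m (cone_C m \<sigma> \<Delta>) \<and> ord_at Q (z_mono m a b v) = ord_at Q f"
proof -
  define d where "d i = eval_floor (\<Delta> i) u" for i
  \<comment> \<open>The value \<open>0\<close> at infinite \<open>d i\<close> is a dummy: then no lower bound is imposed.\<close>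
  define l where "l i = (case d i of Fin n \<Rightarrow> n | _ \<Rightarrow> 0)" for i
  have d: "d i = Pinf \<or> d i = Fin (l i)" if "i \<le> m" for i
    by (rule eval_floor_cases[OF \<Delta>[OF that] u]) (simp_all add: d_def l_def)
  define J where "J P = {i. i \<le> m \<and> P = hyper_pt a b i}" for P
  define I where "I = {i. i \<le> m \<and> Q \<noteq> hyper_pt a b i}"
  have fin [simp]: "finite (J P)" "finite I" for P by (auto simp: J_def I_def)
  have JI: "J Q \<union> I = {..m}" "J Q \<inter> I = {}" by (auto simp: J_def I_def)
  \<comment> \<open>The condition on \<open>f\<close> at \<open>P\<close>; it is void if some \<open>\<Delta> i\<close> with \<open>Q\<^sub>i = P\<close> is empty, and for
    \<open>P\<close> different from all \<open>Q\<^sub>i\<close> it says that \<open>f\<close> is regular at \<open>P\<close>.\<close>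
  have ord_ge: "0 \<le> ord_at P f + sum l (J P)" if "\<forall>i\<in>J P. d i = Fin (l i)" for P
  proof -
    have "divisor_at m \<Delta> a b u P = sum d (J P)" by (simp add: divisor_at_eq J_def d_def)
    also have "\<dots> = Fin (sum l (J P))"
      using that by (subst sum_extended[where l = l]) auto
    finally show ?thesis using f by (auto simp: global_sections_def zero_extended_def dest!: spec[of _ P])
  qed
  have 1: "\<exists>v. sum v (J Q) = ord_at Q f \<and> (\<forall>i\<in>J Q. 0 \<le> Fin (v i) + d i)"
  proof (rule exists_with_sum)
    show "J Q \<noteq> {}" using boundary_point_is_hyper_pt[OF line(2) Q] by (auto simp: J_def)
  qed (use d ord_ge in \<open>auto simp: J_def\<close>)
  have 2: "\<exists>v. sum v I = - ord_at Q f \<and> (\<forall>i\<in>I. 0 \<le> Fin (v i) + d i)"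
  proof (rule exists_with_sum)
    show "I \<noteq> {}" using not_all_hyper_pts_equal[OF line, of Q] by (auto simp: I_def)
    assume dI: "\<forall>i\<in>I. d i = Fin (l i)"
    define T where "T = hyper_pt a b ` I"
    have T: "finite T" "Q \<notin> T" by (auto simp: T_def I_def)
    have JT: "J P = {i \<in> I. hyper_pt a b i = P}" if "P \<noteq> Q" for P
      using that by (auto simp: J_def I_def)
    have "0 \<le> ord_at P f" if "P \<notin> insert Q T" for P
    proof -
      have "J P = {}" using that JT[of P] by (auto simp: T_def)
      then show ?thesis using ord_ge[of P] by simp
    qed
    then have "(\<Sum>P\<in>insert Q T. ord_at P f) \<le> 0"
      using T f(2) by (intro sum_ord_at_le_0) auto
    moreover have "- sum l I \<le> (\<Sum>P\<in>T. ord_at P f)"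
    proof -
      have "sum l I = (\<Sum>P\<in>T. sum l {i \<in> I. hyper_pt a b i = P})"
        unfolding T_def by (rule sum.image_gen) simp
      also have "\<dots> = (\<Sum>P\<in>T. sum l (J P))"
      proof (rule sum.cong[OF refl])
        fix P assume "P \<in> T"
        then have "P \<noteq> Q" using T(2) by blast
        then show "sum l {i \<in> I. hyper_pt a b i = P} = sum l (J P)" by (simp add: JT)
      qed
      finally have "- sum l I = (\<Sum>P\<in>T. - sum l (J P))" by (simp add: sum_negf)
      also have "\<dots> \<le> (\<Sum>P\<in>T. ord_at P f)"
      proof (rule sum_mono)
        fix P assume "P \<in> T"
        then have "P \<noteq> Q" using T(2) by blast
        then show "- sum l (J P) \<le> ord_at P f" using ord_ge[of P] dI JT by auto
      qed
      finally show ?thesis .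
    qed
    ultimately show "0 \<le> - ord_at Q f + sum l I" using T by simp
  qed (use d in \<open>auto simp: I_def\<close>)
  obtain v1 v2 where v1: "sum v1 (J Q) = ord_at Q f" "\<forall>i\<in>J Q. 0 \<le> Fin (v1 i) + d i"
    and v2: "sum v2 I = - ord_at Q f" "\<forall>i\<in>I. 0 \<le> Fin (v2 i) + d i"
    using 1 2 by blast
  define v where "v i = (if i \<in> J Q then v1 i else v2 i)" for i
  have vJ: "sum v (J Q) = ord_at Q f" using v1(1) by (simp add: v_def)
  have "sum v I = sum v2 I" using JI(2) by (intro sum.cong) (auto simp: v_def)
  then have "sum v {..m} = 0"
    using vJ v2(1) JI by (simp add: sum.union_disjoint flip: JI(1))
  then have exp: "hom_exp m (\<lambda>j. if j \<in> {1..m} then v j else 0) i = v i" if "i \<le> m" for i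
    using that by (rule hom_exp_restrict)
  have "0 \<le> Fin (v i) + d i" if "i \<le> m" for i
    using that v1(2) v2(2) JI(1) by (auto simp: v_def)
  then have "(u, \<lambda>j. if j \<in> {1..m} then v j else 0) \<in> dual_lattice_prod m (cone_C m \<sigma> \<Delta>)"
    unfolding dual_lattice_prod_cone_C
    using u exp eval_floor_ge_iff[OF \<Delta> u] by (auto simp: d_def)
  moreover have "ord_at Q (z_mono m a b (\<lambda>j. if j \<in> {1..m} then v j else 0)) = ord_at Q f"
    unfolding ord_at_z_mono[OF line(2)] using vJ exp by (auto simp: J_def intro!: sum.cong)
  ultimately show ?thesis by blast
qed

text \<open>The order at \<open>P\<close> and the coefficient of the divisor at \<open>P\<close> are sums over the same indices, those
  with \<open>Q\<^sub>i = P\<close>, and the required inequality holds summand by summand.\<close>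

lemma monomial_is_section:
  assumes "line_torus m a b \<noteq> {}"
    and \<Delta>: "\<And>i. i \<le> m \<Longrightarrow> \<Delta> i = {} \<or> polyhedron (\<Delta> i) \<and> tailcone (\<Delta> i) = \<sigma>"
    and h: "(u, v) \<in> dual_lattice_prod m (cone_C m \<sigma> \<Delta>)"
  shows "z_mono m a b v \<in> global_sections (divisor_at m \<Delta> a b u)"
proof -
  have u: "u \<in> dual_lattice \<sigma>" using h by (simp add: dual_lattice_prod_cone_C)
  define d where "d i = eval_floor (\<Delta> i) u" for i
  \<comment> \<open>The value \<open>0\<close> at infinite \<open>d i\<close> is a dummy: then no lower bound is imposed.\<close>
  define l where "l i = (case d i of Fin n \<Rightarrow> n | _ \<Rightarrow> 0)" for i
  have d: "d i = Pinf \<or> d i = Fin (l i)" if "i \<le> m" for i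
    by (rule eval_floor_cases[OF \<Delta>[OF that] u]) (simp_all add: d_def l_def)
  have ge: "0 \<le> Fin (hom_exp m v i) + d i" if "i \<le> m" for i
    using h eval_floor_ge_iff[OF \<Delta>[OF that] u] that by (simp add: d_def dual_lattice_prod_cone_C)
  have "0 \<le> Fin (ord_at P (z_mono m a b v)) + divisor_at m \<Delta> a b u P" for P
  proof -
    define J where "J = {i. i \<le> m \<and> P = hyper_pt a b i}"
    have J: "finite J" "\<And>i. i \<in> J \<Longrightarrow> i \<le> m" by (auto simp: J_def)
    have sum: "sum d J = (if \<exists>i\<in>J. d i = Pinf then Pinf else Fin (sum l J))"
      using J d by (intro sum_extended) auto
    have "0 \<le> sum (hom_exp m v) J + sum l J" if "\<not> (\<exists>i\<in>J. d i = Pinf)"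
    proof -
      have "0 \<le> hom_exp m v i + l i" if "i \<in> J" for i
        using ge[of i] d[of i] J that \<open>\<not> (\<exists>i\<in>J. d i = Pinf)\<close> by (auto simp: zero_extended_def)
      then show ?thesis by (simp add: sum_nonneg flip: sum.distrib)
    qed
    moreover have "ord_at P (z_mono m a b v) = sum (hom_exp m v) J"
      unfolding J_def by (rule ord_at_z_mono[OF assms(1)])
    moreover have "divisor_at m \<Delta> a b u P = sum d J"
      by (simp add: divisor_at_eq J_def d_def)
    ultimately show ?thesis
      using sum by (auto simp: zero_extended_def simp del: One_nat_def)
  qed
  then show ?thesis by (simp add: global_sections_def)
qed

section \<open>The value semigroup\<close>

lemma semigroup_gen_image:
  assumes "f 0 = 0" "\<And>x y. f (x + y) = f x + f y"
  shows "semigroup_gen (f ` H) = f ` semigroup_gen H"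
proof (intro equalityI subsetI)
  fix y assume "y \<in> semigroup_gen (f ` H)"
  then show "y \<in> f ` semigroup_gen H"
  proof induction
    case zero
    show ?case using assms(1) semigroup_gen.zero by (metis imageI)
  next
    case (base y)
    then show ?case by (auto intro: semigroup_gen.base)
  next
    case (add x y)
    then obtain x' y' where "x' \<in> semigroup_gen H" "x = f x'" "y' \<in> semigroup_gen H" "y = f y'"
      by blast
    then show ?case by (intro image_eqI[of _ _ "x' + y'"]) (auto simp: assms(2) intro: semigroup_gen.add)
  qed
next
  fix y assume "y \<in> f ` semigroup_gen H"
  then obtain x where "x \<in> semigroup_gen H" "y = f x" by blast
  moreover from this(1) have "f x \<in> semigroup_gen (f ` H)"
    by induction (auto simp: assms intro: semigroup_gen.intros)
  ultimately show "y \<in> semigroup_gen (f ` H)" by simp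
qed

lemma val_single: "f \<noteq> 0 \<Longrightarrow> val \<psi> Q \<gamma> (Poly_Mapping.single u f) = \<psi> u + zscale (ord_at Q f) \<gamma>"
  by (simp add: val_def)

lemma val_attained:
  assumes "F \<noteq> 0"
  obtains u where "u \<in> Poly_Mapping.keys F"
    "val \<psi> Q \<gamma> F = \<psi> u + zscale (ord_at Q (Poly_Mapping.lookup F u)) \<gamma>"
proof -
  have "Poly_Mapping.keys F \<noteq> {}" using assms by simp
  then have "val \<psi> Q \<gamma> F \<in> (\<lambda>u. \<psi> u + zscale (ord_at Q (Poly_Mapping.lookup F u)) \<gamma>) ` Poly_Mapping.keys F"
    unfolding val_def by (intro Min_in) auto
  with that show ?thesis by blast
qed

theorem theorem5p4:
  fixes m :: nat
    and \<sigma> :: "('m::ab_group_add \<Rightarrow> rat) set"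
    and \<Delta> :: "nat \<Rightarrow> ('m \<Rightarrow> rat) set"
    and a b :: "nat \<Rightarrow> 'k::alg_closed_field"
    and H :: "('m \<times> (nat \<Rightarrow> int)) set"
    and \<psi> :: "'m \<Rightarrow> 'g::linordered_ab_group_add"
    and \<gamma> :: 'g
    and Q :: "'k option"
  assumes M: "fg_free_abelian (UNIV :: 'm set)"
    and m: "1 \<le> m"
    and \<sigma>: "polyhedral_cone \<sigma>" "pointed \<sigma>"
    and \<Delta>: "\<And>i. i \<le> m \<Longrightarrow> \<Delta> i = {} \<or> polyhedron (\<Delta> i) \<and> tailcone (\<Delta> i) = \<sigma>"
    and proper: "(\<Sum>i\<le>m. \<Delta> i) \<subset> \<sigma>"
    and line: "spans_line m a b" "line_torus m a b \<noteq> {}"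
    and normal: "normal_domain (A_L m \<sigma> \<Delta> a b)"
    and H: "finite H" "semigroup_gen H = dual_lattice_prod m (cone_C m \<sigma> \<Delta>)"
    and \<Gamma>: "fg_free_abelian (UNIV :: 'g set)"
    and \<psi>: "additive \<psi>"
    and \<gamma>: "0 \<le> \<gamma>"
    and Q: "Q \<notin> line_torus m a b"
  shows "let R = A_L m \<sigma> \<Delta> a b; v = val \<psi> Q \<gamma>; gens = monomial_map m a b ` H in
    semigroup_gen (v ` gens) = value_semigroup R v \<and>
    (full_rank R v \<longrightarrow> khovanskii_basis R v gens)"
proof -
  define R where "R = A_L m \<sigma> \<Delta> a b"
  define v where "v = val \<psi> Q \<gamma>"
  define C where "C = dual_lattice_prod m (cone_C m \<sigma> \<Delta>)"
  define mono where "mono = (monomial_map m a b :: 'm \<times> (nat \<Rightarrow> int) \<Rightarrow> 'm \<Rightarrow>\<^sub>0 'k poly fract)"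
  \<comment> \<open>The valuation of the monomial with exponent \<open>h\<close>, in a form that is visibly additive in \<open>h\<close>.\<close>
  define wt where "wt h = \<psi> (fst h) +
    zscale (\<Sum>i | i \<le> m \<and> Q = hyper_pt a b i. hom_exp m (snd h) i) \<gamma>" for h :: "'m \<times> (nat \<Rightarrow> int)"
  have v_mono: "v (mono h) = wt h" for h
    using z_mono_nonzero[OF line(2)]
    by (simp add: v_def mono_def monomial_map_def val_single wt_def ord_at_z_mono[OF line(2)]
        del: One_nat_def)
  have wt: "wt 0 = 0" "wt (h + h') = wt h + wt h'" for h h'
    by (simp_all add: wt_def additive.zero[OF \<psi>] additive.add[OF \<psi>] hom_exp_0 hom_exp_add
        sum.distrib zscale_add_left)
  have mono_in_R: "mono h \<in> R - {0}" if h: "h \<in> C" for h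
  proof -
    obtain u e where [simp]: "h = (u, e)" by fastforce
    have "u \<in> dual_lattice \<sigma>" using h by (simp add: C_def dual_lattice_prod_cone_C)
    moreover have "z_mono m a b e \<in> global_sections (divisor_at m \<Delta> a b u)"
      using monomial_is_section[OF line(2) \<Delta>] h by (simp add: C_def)
    moreover have "0 \<in> global_sections D" for D :: "'k option \<Rightarrow> int extended"
      by (simp add: global_sections_def)
    moreover have "Poly_Mapping.single u (z_mono m a b e) \<noteq> 0"
      using z_mono_nonzero[OF line(2), of e] by (metis lookup_single_eq lookup_zero)
    ultimately show ?thesis
      by (auto simp: R_def A_L_def mono_def monomial_map_def lookup_single when_def
          simp del: One_nat_def)
  qed
  have "value_semigroup R v = wt ` C"
  proof (intro equalityI subsetI)
    fix g assume "g \<in> value_semigroup R v"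
    then obtain F where F: "F \<in> R" "F \<noteq> 0" "g = v F" by (auto simp: value_semigroup_def)
    obtain u where u: "u \<in> Poly_Mapping.keys F"
      "v F = \<psi> u + zscale (ord_at Q (Poly_Mapping.lookup F u)) \<gamma>"
      using val_attained[OF F(2)] unfolding v_def by blast
    have "u \<in> dual_lattice \<sigma>" using F(1) u(1) by (auto simp: R_def A_L_def)
    moreover have "Poly_Mapping.lookup F u \<in> global_sections (divisor_at m \<Delta> a b u)"
      using F(1) calculation by (auto simp: R_def A_L_def)
    moreover have "Poly_Mapping.lookup F u \<noteq> 0" using u(1) by (simp add: in_keys_iff)
    ultimately obtain e where e: "(u, e) \<in> C"
      "ord_at Q (z_mono m a b e) = ord_at Q (Poly_Mapping.lookup F u)"
      using section_order_realised_by_monomial[of m a b Q \<Delta> \<sigma>, OF line Q \<Delta>] unfolding C_def by blast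
    have "g = wt (u, e)"
      using F(3) u(2) e(2) by (simp add: wt_def ord_at_z_mono[OF line(2)] del: One_nat_def)
    with e(1) show "g \<in> wt ` C" by blast
  next
    fix g assume "g \<in> wt ` C"
    then show "g \<in> value_semigroup R v"
      using mono_in_R by (force simp: value_semigroup_def simp flip: v_mono)
  qed
  moreover have "semigroup_gen (v ` mono ` H) = wt ` C"
    using semigroup_gen_image[of wt H] wt H(2) by (simp add: image_image v_mono C_def)
  ultimately have gen: "semigroup_gen (v ` mono ` H) = value_semigroup R v" by simp
  moreover have "mono ` H \<subseteq> R - {0}"
    using mono_in_R H(2) semigroup_gen.base[of _ H] by (auto simp: C_def)
  ultimately show ?thesis
    unfolding Let_def khovanskii_basis_def R_def[symmetric] v_def[symmetric] mono_def[symmetric]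
    by blast
qed

end
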